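(* Let $f:2^V\to\mathbb R_{\ge0}$ be a (not necessarily monotone) submodular function, $P_1,\dots,P_k$ a partition of $V$ with budgets $n_1,\dots,n_k$, and $S^*$ a maximizer of $f$ over sets $S$ with $|S\cap P_a|\le n_a$ for all $a$. Run Algorithm 4 with the following parameters. (1) Small budget case, $\min_a n_a\le10$: $p=0.3$; for $n_a\ge11$, $d_a=\frac{1-p}{p}=\frac73$; for $n_a=1,\dots,10$, $d_a$ equals respectively $1,\ 1.7961,\ 2.0654,\ 2.1627,\ 2.2107,\ 2.2387,\ 2.2567,\ 2.2692,\ 2.2783,\ 2.2852$. Then, with $Q_a=\max\{1+c_a+d_a,(1-\frac1{n_a})c_a+\frac1p\}$, one has $\frac{1-p}{Q_a}\ge 0.175,\ 0.18,\ 0.18,\ 0.182,\ 0.183,\ 0.183,\ 0.184,\ 0.185,\ 0.185,\ 0.185$ for $n_a=1,\dots,10$ respectively, and $\frac{1-p}{Q_a}\ge0.1896\left(1-\frac{0.7771}{n_a}\right)$ for $n_a\ge11$. (2) Large budget case, $\min_a n_a\ge11$: let $d=1.9532$ (an approximate solution of $e^d(d-1)-d^2-2d+1=0$), $p=\frac1{d+1}$ and $d_a=d$ for all $a$. Then $\frac{1-p}{Q_a}\ge0.1921\left(1-\frac{0.7676}{n_a}\right)$. In both cases $\mathbb E[f(S)]\ge\min_a\frac{1-p}{Q_a}f(S^* )$; the approximation ratio is at least $0.175$ for all budgets and at least $0.1921\left(1-\frac{0.7676}{\min_a n_a}\right)$ when $\min_a n_a\ge11$.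
   Context: Algorithm 4. The elements of $V$ are labeled $1,\dots,m$ in arbitrary arrival order. Given $p\in(0,1)$ and $d_a>0$, set $c_a=(1+d_a)/\big((1+d_a/n_a)^{n_a}-1\big)$ and $g_a(i)=\frac{c_a}{n_a}(1+d_a/n_a)^{i-1}$ for $i\in[n_a]$. Maintain $S$, initially $\emptyset$, and thresholds $\beta_a=0$. For $t=1,\dots,m$: let $a$ be the index with $t\in P_a$, compute $w_t=f(S\cup\{t\})-f(S)$ (for the current $S$), and draw $Z_t\sim\mathrm{Bernoulli}(p)$ independently of everything else; if $w_t\ge\beta_a$ and $Z_t=1$, then: if $|S\cap P_a|<n_a$ add $t$ to $S$, otherwise remove from $S$ an element $t'\in S\cap P_a$ minimizing $w_{t'}$ and add $t$; then set $\beta_a=\sum_{i=1}^{n_a}w_a(i)g_a(i)$, where $w_a(i)$ is the $i$-th largest value in $\{w_s:s\in S\cap P_a\}$ ($0$ if $i>|S\cap P_a|$). Weights are never recomputed. Otherwise $t$ is discarded. Output the final $S$. *)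

theory Defs
  imports "HOL-Probability.Probability"
begin

definition c_par :: "real \<Rightarrow> nat \<Rightarrow> real" where
  "c_par d n = (1 + d) / ((1 + d / real n) ^ n - 1)"

definition g_par :: "real \<Rightarrow> nat \<Rightarrow> nat \<Rightarrow> real" where
  "g_par d n i = c_par d n / real n * (1 + d / real n) ^ (i - 1)"

definition Q_par :: "real \<Rightarrow> real \<Rightarrow> nat \<Rightarrow> real" where
  "Q_par p d n = max (1 + c_par d n + d) ((1 - 1 / real n) * c_par d n + 1 / p)"

definition kth_largest :: "real list \<Rightarrow> nat \<Rightarrow> real" where
  "kth_largest xs i = (if 1 \<le> i \<and> i \<le> length xs then rev (sort xs) ! (i - 1) else 0)"

type_synonym alg_state = "nat set \<times> (nat \<Rightarrow> real) \<times> (nat \<Rightarrow> real)"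

text \<open>One step of Algorithm 4 at time t. State: (S, stored weights w, thresholds beta).
  prt t is the index a with t in P_a; nb a = n_a; dd a = d_a; Z t is the coin;
  sel A w picks an element of A minimizing w (tie-breaking rule).\<close>
definition alg_step ::
  "(nat set \<Rightarrow> real) \<Rightarrow> (nat \<Rightarrow> nat) \<Rightarrow> (nat \<Rightarrow> nat) \<Rightarrow> (nat \<Rightarrow> real)
   \<Rightarrow> (nat set \<Rightarrow> (nat \<Rightarrow> real) \<Rightarrow> nat) \<Rightarrow> (nat \<Rightarrow> bool) \<Rightarrow> nat \<Rightarrow> alg_state \<Rightarrow> alg_state" where
  "alg_step f prt nb dd sel Z t st = (case st of (S, w, \<beta>) \<Rightarrow>
     (let a = prt t; wt = f (S \<union> {t}) - f S in
      if \<beta> a \<le> wt \<and> Z t then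
        (let Pa = {s. prt s = a};
             S' = (if card (S \<inter> Pa) < nb a then insert t S
                   else insert t (S - {sel (S \<inter> Pa) w}));
             w' = w(t := wt);
             vals = map w' (sorted_list_of_set (S' \<inter> Pa));
             \<beta>' = \<beta>(a := (\<Sum>i = 1..nb a. kth_largest vals i * g_par (dd a) (nb a) i))
         in (S', w', \<beta>'))
      else (S, w, \<beta>)))"

definition alg_run ::
  "(nat set \<Rightarrow> real) \<Rightarrow> (nat \<Rightarrow> nat) \<Rightarrow> (nat \<Rightarrow> nat) \<Rightarrow> (nat \<Rightarrow> real)
   \<Rightarrow> (nat set \<Rightarrow> (nat \<Rightarrow> real) \<Rightarrow> nat) \<Rightarrow> nat \<Rightarrow> (nat \<Rightarrow> bool) \<Rightarrow> nat set" where
  "alg_run f prt nb dd sel m Z =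
     fst (foldl (\<lambda>st t. alg_step f prt nb dd sel Z t st) ({}, (\<lambda>_. 0), (\<lambda>_. 0)) [1..<Suc m])"

definition alg_expect ::
  "real \<Rightarrow> (nat set \<Rightarrow> real) \<Rightarrow> (nat \<Rightarrow> nat) \<Rightarrow> (nat \<Rightarrow> nat) \<Rightarrow> (nat \<Rightarrow> real)
   \<Rightarrow> (nat set \<Rightarrow> (nat \<Rightarrow> real) \<Rightarrow> nat) \<Rightarrow> nat \<Rightarrow> real" where
  "alg_expect p f prt nb dd sel m =
     measure_pmf.expectation (Pi_pmf {1..m} False (\<lambda>_. bernoulli_pmf p))
       (\<lambda>Z. f (alg_run f prt nb dd sel m Z))"

definition d_small :: "nat \<Rightarrow> real" where
  "d_small n = (if 1 \<le> n \<and> n \<le> 10 then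
      [1, 1.7961, 2.0654, 2.1627, 2.2107, 2.2387, 2.2567, 2.2692, 2.2783, 2.2852] ! (n - 1)
    else 7 / 3)"

definition ratio_small :: "nat \<Rightarrow> real" where
  "ratio_small n = [0.175, 0.18, 0.18, 0.182, 0.183, 0.183, 0.184, 0.185, 0.185, 0.185] ! (n - 1)"

end

theory Submission
  imports Defs
begin

text \<open>
  Let \<open>A\<^sub>t\<close> be the set of elements accepted up to time \<open>t\<close>, \<open>O\<^sub>t\<close> the part of \<open>S\<^sup>*\<close> that has arrived,
  and \<open>W\<^sub>a\<close> the total weight of the current \<open>S \<inter> P\<^sub>a\<close>. The potential
  \<open>f (O\<^sub>t \<union> A\<^sub>t) + (\<Sum>a. (n\<^sub>a - card (O\<^sub>t \<inter> P\<^sub>a)) * \<beta>\<^sub>a) - (\<Sum>a. Q\<^sub>a * W\<^sub>a)\<close>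
  does not increase in expectation. By submodularity its first term grows by at most the weight of
  the new element. The thresholds are designed such that accepting an element of weight \<open>x\<close> in
  place of one of weight \<open>u\<close> raises \<open>n\<^sub>a * \<beta>\<^sub>a\<close> by at most
  \<open>d\<^sub>a * \<beta>\<^sub>a - (1 + c\<^sub>a + d\<^sub>a) * u + c\<^sub>a * x\<close>, and \<open>Q\<^sub>a\<close> is exactly what pays for this, both for an
  element outside \<open>S\<^sup>*\<close> and, averaged over the coin, for an element of \<open>S\<^sup>*\<close>. At the end this bounds
  the expectation of \<open>f (S\<^sup>* \<union> A)\<close> by that of \<open>f {} + (\<Sum>a. Q\<^sub>a * W\<^sub>a)\<close>. As \<open>A\<close> contains only elements whose
  coin came up heads, the former is at least \<open>(1 - p) * f S\<^sup>*\<close>, while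
  \<open>f {} + (\<Sum>a. W\<^sub>a) \<le> f S\<close> because weights are marginal values with respect to supersets of the surviving
  earlier elements.
\<close>

section \<open>Thresholds\<close>

lemma le_nth_iff_filter:
  fixes L :: "'a::linorder list"
  assumes "sorted_wrt (\<ge>) L" "j < length L"
  shows "y \<le> L ! j \<longleftrightarrow> j < length (filter (\<lambda>z. y \<le> z) L)"
  using assms
proof (induction L arbitrary: j)
  case (Cons a L)
  show ?case
  proof (cases "y \<le> a")
    case True
    then show ?thesis using Cons by (cases j) auto
  next
    case False
    then have *: "\<forall>z\<in>set L. \<not> y \<le> z" using Cons.prems(1) by auto
    then have "filter (\<lambda>z. y \<le> z) L = []" by (simp add: filter_empty_conv)
    moreover have "\<not> y \<le> (a # L) ! j" using * False Cons.prems(2) by (cases j) auto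
    ultimately show ?thesis using False by simp
  qed
qed simp

text \<open>Counting the entries above a level replaces all reasoning about sorting later on. The
  level must be positive because ranks beyond the length have the default value 0.\<close>

lemma le_kth_largest_iff:
  assumes "0 < y" "1 \<le> i"
  shows "y \<le> kth_largest xs i \<longleftrightarrow> i \<le> length (filter (\<lambda>z. y \<le> z) xs)"
proof (cases "i \<le> length xs")
  case True
  have s: "sorted_wrt (\<ge>) (rev (sort xs))"
    by (simp add: sorted_wrt_rev)
  have l: "length (filter (\<lambda>z. y \<le> z) (rev (sort xs))) = length (filter (\<lambda>z. y \<le> z) xs)"
    by (metis filter_sort length_rev length_sort rev_filter)
  show ?thesis
    using le_nth_iff_filter[OF s, of "i - 1" y] l True assms by (auto simp: kth_largest_def)
next
  case False
  then show ?thesis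
    using assms le_trans[OF _ length_filter_le] by (fastforce simp: kth_largest_def)
qed

lemma kth_largest_nonneg: "\<forall>z\<in>set xs. 0 \<le> z \<Longrightarrow> 0 \<le> kth_largest xs i"
  using nth_mem[of "i - 1" "rev (sort xs)"] by (auto simp: kth_largest_def simp del: nth_mem)

lemma kth_largest_cong_mset:
  assumes "mset xs = mset ys"
  shows "kth_largest xs = kth_largest ys"
proof -
  have "sort xs = sort ys" using assms by (metis sorted_list_of_multiset_mset)
  moreover have "length xs = length ys" using assms by (rule mset_eq_length)
  ultimately show ?thesis by (simp add: fun_eq_iff kth_largest_def)
qed

text \<open>A nonnegative real is determined by the positive numbers below it, the only levels that
  \<open>le_kth_largest_iff\<close> can test.\<close>

lemma nonneg_real_eqI:
  fixes a b :: real
  assumes "0 \<le> a" "0 \<le> b" "\<And>y. 0 < y \<Longrightarrow> y \<le> a \<longleftrightarrow> y \<le> b"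
  shows "a = b"
  using assms(3)[of a] assms(3)[of b] assms(1,2) by (cases "a = 0"; cases "b = 0") auto

lemma kth_largest_antimono:
  assumes "\<forall>z\<in>set xs. 0 \<le> z" "1 \<le> i" "i \<le> j"
  shows "kth_largest xs j \<le> kth_largest xs i"
proof (cases "0 < kth_largest xs j")
  case True
  then show ?thesis
    using le_kth_largest_iff[OF True, of j xs] le_kth_largest_iff[OF True, of i xs] assms by simp
next
  case False
  then show ?thesis using kth_largest_nonneg[OF assms(1), of i] by simp
qed

text \<open>Values above \<open>x\<close> keep their rank and the others move down by one. Rank 1 is
  separate because \<open>kth_largest xs 0\<close> is 0 by convention and would cap \<open>x\<close>
  at 0.\<close>

lemma kth_largest_Cons:
  assumes nn: "\<forall>z\<in>set xs. 0 \<le> z" "0 \<le> x" and i: "1 \<le> i"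
  shows "kth_largest (x # xs) i =
    max (kth_largest xs i) (if i = 1 then x else min (kth_largest xs (i - 1)) x)"
proof (rule nonneg_real_eqI)
  fix y :: real assume y: "0 < y"
  show "y \<le> kth_largest (x # xs) i \<longleftrightarrow>
    y \<le> max (kth_largest xs i) (if i = 1 then x else min (kth_largest xs (i - 1)) x)"
    using le_kth_largest_iff[OF y i, of "x # xs"] le_kth_largest_iff[OF y i, of xs]
      le_kth_largest_iff[OF y, of "i - 1" xs] i
    by (auto simp: le_max_iff_disj)
qed (use assms kth_largest_nonneg[of "x # xs" i] kth_largest_nonneg[OF nn(1)] in \<open>auto simp: le_max_iff_disj\<close>)

text \<open>At a level up to \<open>y\<close> all of \<open>xs\<close> is counted anyway, so one
  more entry matters only beyond rank \<open>length xs\<close>; at a higher level \<open>y\<close>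
  is not counted.\<close>

lemma kth_largest_Cons_le:
  assumes "\<forall>z\<in>set xs. 0 \<le> z" "0 \<le> y" "\<forall>z\<in>set xs. y \<le> z" "1 \<le> i" "i \<le> length xs"
  shows "kth_largest (y # xs) i = kth_largest xs i"
proof (rule nonneg_real_eqI)
  fix Y :: real assume Y: "0 < Y"
  have "Y \<le> y \<Longrightarrow> filter (\<lambda>z. Y \<le> z) xs = xs"
    using assms(3) by (auto intro!: filter_True)
  then show "Y \<le> kth_largest (y # xs) i \<longleftrightarrow> Y \<le> kth_largest xs i"
    using assms(5) le_kth_largest_iff[OF Y assms(4)] by auto
qed (use assms kth_largest_nonneg[of xs i] kth_largest_nonneg[of "y # xs" i] in auto)

lemma kth_largest_last:
  assumes "\<forall>z\<in>set xs. 0 \<le> z" "0 \<le> y" "\<forall>z\<in>set xs. y \<le> z"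
  shows "kth_largest (y # xs) (Suc (length xs)) = y"
proof (rule nonneg_real_eqI)
  fix Y :: real assume Y: "0 < Y"
  have "Y \<le> y \<Longrightarrow> filter (\<lambda>z. Y \<le> z) xs = xs"
    using assms(3) by (auto intro!: filter_True)
  then show "Y \<le> kth_largest (y # xs) (Suc (length xs)) \<longleftrightarrow> Y \<le> y"
    using le_trans[OF _ length_filter_le, of "Suc (length xs)" "\<lambda>z. Y \<le> z" xs]
    by (subst le_kth_largest_iff[OF Y]) auto
qed (use assms kth_largest_nonneg[of "y # xs"] in auto)

text \<open>The threshold as a function of the stored weights alone, so that an update can be
  analysed apart from the algorithm. The empty list gives the initial threshold 0.\<close>

definition thr :: "real \<Rightarrow> nat \<Rightarrow> real list \<Rightarrow> real" where
  "thr d n xs = (\<Sum>i = 1..n. kth_largest xs i * g_par d n i)"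

text \<open>If \<open>x\<close> is at least every \<open>u i\<close>, each value moves down one
  rank, where its weight is \<open>q\<close> times larger, and the first two terms give the sum
  exactly. For smaller \<open>x\<close> the last term carries the excess of \<open>u j\<close> over
  \<open>x\<close> through the induction; it vanishes once \<open>u j \<le> x\<close>.\<close>

lemma shifted_sum_bound:
  fixes u v g :: "nat \<Rightarrow> real" and q x :: real
  assumes g0: "\<And>i. 0 \<le> g i" and g: "\<And>i. 1 \<le> i \<Longrightarrow> g (Suc i) = q * g i" and q: "1 \<le> q"
    and v: "\<And>i. 1 \<le> i \<Longrightarrow> v i = max (u i) (if i = 1 then x else min (u (i - 1)) x)"
    and anti: "\<And>i. 1 \<le> i \<Longrightarrow> u (Suc i) \<le> u i" and j: "1 \<le> j"
  shows "(\<Sum>i = 1..j. v i * g i)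
    \<le> x * g 1 + q * ((\<Sum>i = 1..j. u i * g i) - u j * g j) + (u j - min (u j) x) * g j"
  using j
proof (induction j rule: dec_induct)
  case base
  then show ?case using v[of 1] by (auto simp: max_def min_def algebra_simps)
next
  case (step j)
  define r where "r = u j - min (u j) x"
  have r: "0 \<le> r" by (simp add: r_def)
  \<comment> \<open>The excess over \<open>x\<close> stays at its rank, while the values truncated
    at \<open>x\<close> move down by one.\<close>
  have vS: "v (Suc j) = u (Suc j) - min (u (Suc j)) x + min (u j) x"
    using v[of "Suc j"] anti[of j] step by (auto simp: max_def min_def)
  \<comment> \<open>As \<open>q \<ge> 1\<close>, the excess left from rank \<open>j\<close> may be
    charged the larger weight of rank \<open>Suc j\<close>.\<close>
  have "r * g j \<le> r * (q * g j)"
    using r q g0[of j] by (intro mult_left_mono) (auto simp: mult_le_cancel_right1)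
  moreover have "(\<Sum>i = 1..Suc j. h i) = (\<Sum>i = 1..j. h i) + h (Suc j)" for h :: "nat \<Rightarrow> real"
    by simp
  ultimately show ?case
    using step.IH unfolding r_def by (simp add: vS g[OF step(1)] algebra_simps)
qed

section \<open>Geometric coefficients and the growth of the threshold\<close>

lemma c_par_facts:
  assumes "0 < d" "1 \<le> n"
  shows "1 < (1 + d / real n) ^ n" "0 < c_par d n"
    and "c_par d n * (1 + d / real n) ^ n = c_par d n + 1 + d"
proof -
  show *: "1 < (1 + d / real n) ^ n" using assms by (simp add: one_less_power)
  then show "0 < c_par d n" using assms by (simp add: c_par_def)
  show "c_par d n * (1 + d / real n) ^ n = c_par d n + 1 + d"
    using * by (simp add: c_par_def field_simps)
qed

lemma g_par_Suc: "1 \<le> i \<Longrightarrow> g_par d n (Suc i) = (1 + d / real n) * g_par d n i"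
  by (cases i) (auto simp: g_par_def)

lemma g_par_nonneg: "0 < d \<Longrightarrow> 1 \<le> n \<Longrightarrow> 0 \<le> g_par d n i"
  using c_par_facts(2)[of d n] by (simp add: g_par_def)

lemma sum_g_par:
  assumes "0 < d" "1 \<le> n"
  shows "(\<Sum>i = 1..n. g_par d n i) = (1 + d) / d"
proof -
  have "(\<Sum>i = 1..n. g_par d n i) = (\<Sum>i<n. c_par d n / real n * (1 + d / real n) ^ i)"
    by (rule sum.reindex_bij_witness[of _ Suc "\<lambda>i. i - 1"]) (auto simp: g_par_def)
  also have "\<dots> = c_par d n / real n * (((1 + d / real n) ^ n - 1) / (d / real n))"
    using assms by (subst sum_distrib_left[symmetric], subst geometric_sum) auto
  also have "\<dots> = (c_par d n * (1 + d / real n) ^ n - c_par d n) / d"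
    using assms by (simp add: field_simps)
  also have "\<dots> = (1 + d) / d" using c_par_facts(3)[OF assms] by simp
  finally show ?thesis .
qed

lemma thr_nonneg:
  "0 < d \<Longrightarrow> 1 \<le> n \<Longrightarrow> \<forall>z\<in>set xs. 0 \<le> z \<Longrightarrow> 0 \<le> thr d n xs"
  unfolding thr_def by (intro sum_nonneg mult_nonneg_nonneg kth_largest_nonneg g_par_nonneg)

text \<open>All \<open>n\<close> order statistics are bounded below by the last one, and the
  coefficients sum to \<open>(1 + d) / d\<close>. Thus a threshold exceeds the weight to be evicted
  by this factor.\<close>

lemma thr_ge:
  assumes "0 < d" "1 \<le> n" "\<forall>z\<in>set xs. 0 \<le> z"
  shows "(1 + d) / d * kth_largest xs n \<le> thr d n xs"
proof -
  have "(1 + d) / d * kth_largest xs n = (\<Sum>i = 1..n. kth_largest xs n * g_par d n i)"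
    using sum_g_par[OF assms(1,2)] by (simp add: sum_distrib_left[symmetric])
  also have "\<dots> \<le> thr d n xs"
    unfolding thr_def using assms
    by (intro sum_mono mult_right_mono kth_largest_antimono g_par_nonneg) auto
  finally show ?thesis .
qed

text \<open>This is \<open>shifted_sum_bound\<close> at \<open>j = n\<close>, where
  \<open>le\<close> removes the excess term, multiplied by \<open>n\<close>: the normalisation of
  \<open>c_par\<close> turns the coefficients into \<open>c\<close>, \<open>n + d\<close> and
  \<open>c + 1 + d\<close>. Only the first \<open>n\<close> ranks of \<open>ys\<close> are
  prescribed, because a full part drops its minimum.\<close>

lemma thr_step:
  assumes d: "0 < d" "1 \<le> n" and nn: "\<forall>z\<in>set xs. 0 \<le> z" "0 \<le> x"
    and ys: "\<And>i. 1 \<le> i \<Longrightarrow> i \<le> n \<Longrightarrow> kth_largest ys i = kth_largest (x # xs) i"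
    and le: "kth_largest xs n \<le> x"
  shows "thr d n xs \<le> thr d n ys"
    and "real n * (thr d n ys - thr d n xs)
      \<le> d * thr d n xs - (c_par d n + 1 + d) * kth_largest xs n + c_par d n * x"
proof -
  let ?u = "kth_largest xs" and ?v = "kth_largest (x # xs)" and ?g = "g_par d n"
  let ?q = "1 + d / real n"
  have ys': "thr d n ys = thr d n (x # xs)"
    unfolding thr_def by (intro sum.cong) (auto simp: ys)
  show "thr d n xs \<le> thr d n ys"
    unfolding ys' unfolding thr_def using d nn
    by (intro sum_mono mult_right_mono g_par_nonneg) (auto simp: kth_largest_Cons)
  have "thr d n (x # xs) \<le> x * ?g 1 + ?q * (thr d n xs - ?u n * ?g n)
      + (?u n - min (?u n) x) * ?g n"
    unfolding thr_def using d nn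
    by (intro shifted_sum_bound kth_largest_Cons kth_largest_antimono g_par_nonneg g_par_Suc) auto
  also have "\<dots> = x * ?g 1 + ?q * thr d n xs - ?u n * (?q * ?g n)"
    using le by (simp add: algebra_simps)
  finally have "real n * thr d n (x # xs) \<le>
      real n * (x * ?g 1 + ?q * thr d n xs - ?u n * (?q * ?g n))"
    by (intro mult_left_mono) auto
  moreover have "real n * ?g 1 = c_par d n" using d by (simp add: g_par_def)
  moreover have "real n * (?q * ?g n) = c_par d n + 1 + d"
  proof -
    have "?q * ?g n = c_par d n / real n * ?q ^ n" using d by (cases n) (auto simp: g_par_def)
    then show ?thesis using d c_par_facts(3)[OF d] by simp
  qed
  moreover have "real n * ?q = real n + d" using d by (simp add: field_simps)
  moreover have "real n * (x * ?g 1 + ?q * thr d n xs - ?u n * (?q * ?g n))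
      = x * (real n * ?g 1) + (real n * ?q) * thr d n xs - ?u n * (real n * (?q * ?g n))"
    by (simp add: algebra_simps)
  ultimately have "real n * thr d n (x # xs)
      \<le> x * c_par d n + (real n + d) * thr d n xs - ?u n * (c_par d n + 1 + d)"
    by (simp only:)
  then show "real n * (thr d n ys - thr d n xs)
      \<le> d * thr d n xs - (c_par d n + 1 + d) * ?u n + c_par d n * x"
    unfolding ys' by (simp add: algebra_simps)
qed

text \<open>Here \<open>b\<close> is the old threshold, \<open>D\<close> its increase,
  \<open>x\<close> the new weight and \<open>u\<close> the evicted one. The first bound pays for an
  accepted element outside the optimum. The second pays for an element of the optimum: averaging
  \<open>x - b\<close> over both coin outcomes and dividing by \<open>p\<close> yields
  \<open>(x - b) / p\<close>. The two entries of \<open>Q_par\<close> come from the two extreme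
  values of \<open>b\<close>.\<close>

lemma gain_bounds:
  fixes b D x u p :: real
  assumes d: "0 < d" "1 \<le> n" and p: "0 < p"
    and u: "0 \<le> u" "(1 + d) / d * u \<le> b" and x: "b \<le> x"
    and D: "real n * D \<le> d * b - (c_par d n + 1 + d) * u + c_par d n * x"
  shows "x + real n * D \<le> Q_par p d n * (x - u)"
    and "(x - b) / p + (real n - 1) * D \<le> Q_par p d n * (x - u)"
proof -
  let ?c = "c_par d n" and ?Q = "Q_par p d n"
  have c: "0 < ?c" using c_par_facts d by blast
  have "u \<le> (1 + d) / d * u" using d u by (simp add: field_simps)
  then have ux: "u \<le> b" "u \<le> x" using u x by auto
  have Q: "(1 + ?c + d) * (x - u) \<le> ?Q * (x - u)"
    "((1 - 1 / real n) * ?c + 1 / p) * (x - u) \<le> ?Q * (x - u)"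
    using ux by (auto intro!: mult_right_mono simp: Q_par_def)
  have "d * b \<le> d * x" using d x by simp
  then have 1: "x + (d * b - (?c + 1 + d) * u + ?c * x) \<le> (1 + ?c + d) * (x - u)"
    by (simp add: algebra_simps)
  show "x + real n * D \<le> ?Q * (x - u)" using 1 D Q by linarith
  define r where "r = 1 - 1 / real n"
  have r: "0 \<le> r" "r \<le> 1" using d by (auto simp: r_def)
  define L where "L y = (x - y) / p + r * (d * y - (?c + 1 + d) * u + ?c * x)" for y
  have "(real n - 1) * D = r * (real n * D)" using d by (simp add: r_def field_simps)
  also have "\<dots> \<le> r * (d * b - (?c + 1 + d) * u + ?c * x)" using D r by (intro mult_left_mono)
  finally have LL: "(x - b) / p + (real n - 1) * D \<le> L b" by (simp add: L_def)
  have Lx: "L x \<le> ?Q * (x - u)"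
  proof -
    have "L x = r * ((1 + ?c + d) * (x - u) - x)" by (simp add: L_def algebra_simps)
    also have "\<dots> \<le> r * ((1 + ?c + d) * (x - u))" using r ux u by (intro mult_left_mono) auto
    also have "\<dots> \<le> 1 * ((1 + ?c + d) * (x - u))"
      using r ux c d by (intro mult_right_mono mult_nonneg_nonneg) auto
    finally show ?thesis using Q by simp
  qed
  \<comment> \<open>The least threshold that \<open>u\<close> permits; there \<open>d * l\<close>
    cancels \<open>(1 + d) * u\<close>, and the second entry of \<open>Q_par\<close>
    remains.\<close>
  define l where "l = (1 + d) / d * u"
  have Ll: "L l \<le> ?Q * (x - u)"
  proof -
    have "d * l = (1 + d) * u" using d by (simp add: l_def)
    then have "L l = (r * ?c + 1 / p) * (x - u) - (l - u) / p"
      unfolding L_def by (simp add: algebra_simps diff_divide_distrib)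
    moreover have "0 \<le> (l - u) / p" using p \<open>u \<le> (1 + d) / d * u\<close> by (simp add: l_def)
    ultimately show ?thesis using Q(2) unfolding r_def by linarith
  qed
  \<comment> \<open>L is affine, hence bounded on the interval from l to x by its values at the ends.\<close>
  have "L b \<le> ?Q * (x - u)"
  proof (cases "0 \<le> r * d - 1 / p")
    case True
    have "L x - L b = (r * d - 1 / p) * (x - b)" by (simp add: L_def algebra_simps diff_divide_distrib)
    moreover have "0 \<le> (r * d - 1 / p) * (x - b)" using True x by (intro mult_nonneg_nonneg) auto
    ultimately show ?thesis using Lx by linarith
  next
    case False
    have "L l - L b = (1 / p - r * d) * (b - l)" by (simp add: L_def algebra_simps diff_divide_distrib)
    moreover have "0 \<le> (1 / p - r * d) * (b - l)" using False u by (intro mult_nonneg_nonneg) (auto simp: l_def)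
    ultimately show ?thesis using Ll by linarith
  qed
  then show "(x - b) / p + (real n - 1) * D \<le> ?Q * (x - u)" using LL by linarith
qed

section \<open>Random subsets\<close>

abbreviation coins :: "real \<Rightarrow> 'a set \<Rightarrow> ('a \<Rightarrow> bool) pmf" where
  "coins p D \<equiv> Pi_pmf D False (\<lambda>_. bernoulli_pmf p)"

lemma integrable_coins [simp]:
  "finite D \<Longrightarrow> integrable (measure_pmf (coins p D)) (F :: _ \<Rightarrow> real)"
  by (rule integrable_measure_pmf_finite) (auto simp: set_Pi_pmf intro!: finite_PiE_dflt)

lemma expectation_coins_insert:
  fixes F :: "('a \<Rightarrow> bool) \<Rightarrow> real"
  assumes D: "finite D" "t \<notin> D" and p: "0 \<le> p" "p \<le> 1"
  shows "measure_pmf.expectation (coins p (insert t D)) F =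
    p * measure_pmf.expectation (coins p D) (\<lambda>Z. F (Z(t := True)))
    + (1 - p) * measure_pmf.expectation (coins p D) (\<lambda>Z. F (Z(t := False)))"
proof -
  have "coins p (insert t D)
      = bernoulli_pmf p \<bind> (\<lambda>b. map_pmf (\<lambda>Z. Z(t := b)) (coins p D))"
    by (subst Pi_pmf_insert'[OF D]) (simp add: map_pmf_def)
  then have "measure_pmf.expectation (coins p (insert t D)) F =
      measure_pmf.expectation (bernoulli_pmf p)
        (\<lambda>b. measure_pmf.expectation (map_pmf (\<lambda>Z. Z(t := b)) (coins p D)) F)"
    using D by (simp add: pmf_expectation_bind[of UNIV] set_Pi_pmf finite_PiE_dflt
        integral_measure_pmf[of UNIV])
  then show ?thesis using p by simp
qed

text \<open>Resampling one coin preserves the product distribution. This averages over the coin of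
  the current step while all other coins stay random.\<close>

lemma expectation_coins_flip:
  fixes F :: "('a \<Rightarrow> bool) \<Rightarrow> real"
  assumes D: "finite D" "t \<in> D" and p: "0 \<le> p" "p \<le> 1"
  shows "measure_pmf.expectation (coins p D) F =
    measure_pmf.expectation (coins p D) (\<lambda>Z. p * F (Z(t := True)) + (1 - p) * F (Z(t := False)))"
proof -
  have *: "insert t (D - {t}) = D" using D by auto
  show ?thesis
    using expectation_coins_insert[of "D - {t}" t p F]
      expectation_coins_insert[of "D - {t}" t p
        "\<lambda>Z. p * F (Z(t := True)) + (1 - p) * F (Z(t := False))"] D p
    unfolding * by (simp add: algebra_simps)
qed

lemma expectation_coins_single:
  assumes "finite D" "t \<in> D" "0 \<le> p" "p \<le> 1"
  shows "measure_pmf.expectation (coins p D) (\<lambda>Z. of_bool (Z t)) = p"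
  using expectation_coins_flip[OF assms, of "\<lambda>Z. of_bool (Z t)"] by simp

text \<open>Removing the elements in increasing order of their inclusion probability makes the
  telescoping sum of marginal values dominate a nonnegative combination of values of \<open>g\<close>.\<close>
lemma expectation_sampled_subset_ge:
  fixes g :: "'a set \<Rightarrow> real" and M :: "'b pmf" and R :: "'b \<Rightarrow> 'a set"
  assumes "finite W" and int: "\<And>F :: 'b \<Rightarrow> real. integrable M F"
    and nonneg: "\<And>X. X \<subseteq> W \<Longrightarrow> 0 \<le> g X"
    and submod: "\<And>X Y t. X \<subseteq> Y \<Longrightarrow> Y \<subseteq> W \<Longrightarrow> t \<in> W \<Longrightarrow> t \<notin> Y \<Longrightarrow>
      g (insert t Y) - g Y \<le> g (insert t X) - g X"
    and prob: "\<And>t. t \<in> W \<Longrightarrow> measure_pmf.expectation M (\<lambda>z. of_bool (t \<in> R z)) \<le> p"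
    and p: "0 \<le> p"
  shows "(1 - p) * g {} \<le> measure_pmf.expectation M (\<lambda>z. g (W \<inter> R z))"
proof -
  define q where "q t = measure_pmf.expectation M (\<lambda>z. of_bool (t \<in> R z) :: real)" for t
  have q0: "0 \<le> q t" for t unfolding q_def by (intro Bochner_Integration.integral_nonneg) simp
  \<comment> \<open>The term \<open>c * g X\<close>, with \<open>c\<close> below every inclusion
    probability in \<open>X\<close>, strengthens the induction; the claim is the case
    \<open>c = 0\<close>.\<close>
  have "\<forall>c. 0 \<le> c \<and> c \<le> p \<and> (\<forall>t\<in>X. c \<le> q t) \<longrightarrow> X \<subseteq> W \<longrightarrow>
      (1 - p) * g {} + c * g X \<le> measure_pmf.expectation M (\<lambda>z. g (X \<inter> R z))"
    if "finite X" for X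
    using that
  proof (induction X rule: finite_ranking_induct[where f = "\<lambda>t. - q t"])
    case empty
    show ?case using nonneg[of "{}"] by (auto simp: algebra_simps intro!: mult_right_mono)
  next
    case (insert t X)
    show ?case
    proof (cases "t \<in> X")
      case True
      then show ?thesis using insert by (simp add: insert_absorb)
    next
      case False
      show ?thesis
      proof (intro allI impI)
        fix c assume c: "0 \<le> c \<and> c \<le> p \<and> (\<forall>s\<in>insert t X. c \<le> q s)" and W: "insert t X \<subseteq> W"
        \<comment> \<open>The ranking inserts \<open>t\<close> after all elements of larger or equal
          probability, so \<open>c = q t\<close> is admissible for \<open>X\<close>.\<close>
        have "(1 - p) * g {} + q t * g X \<le> measure_pmf.expectation M (\<lambda>z. g (X \<inter> R z))"
          using insert W q0 prob[of t] by (auto simp: q_def)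
        moreover have "c * g (insert t X) \<le> q t * g (insert t X)"
          using c W nonneg by (intro mult_right_mono) auto
        moreover have "measure_pmf.expectation M (\<lambda>z. g (X \<inter> R z))
            + q t * (g (insert t X) - g X)
          \<le> measure_pmf.expectation M (\<lambda>z. g (insert t X \<inter> R z))"
        proof -
          have "measure_pmf.expectation M (\<lambda>z. g (X \<inter> R z)) + q t * (g (insert t X) - g X)
            = measure_pmf.expectation M
                (\<lambda>z. g (X \<inter> R z) + of_bool (t \<in> R z) * (g (insert t X) - g X))"
            by (simp add: q_def int)
          also have "\<dots> \<le> measure_pmf.expectation M (\<lambda>z. g (insert t X \<inter> R z))"
          proof (intro integral_mono int)
            fix z
            show "g (X \<inter> R z) + of_bool (t \<in> R z) * (g (insert t X) - g X)
                \<le> g (insert t X \<inter> R z)"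
              using submod[of "X \<inter> R z" X t] W False by (cases "t \<in> R z") auto
          qed
          finally show ?thesis .
        qed
        ultimately show "(1 - p) * g {} + c * g (insert t X)
            \<le> measure_pmf.expectation M (\<lambda>z. g (insert t X \<inter> R z))"
          by (simp add: algebra_simps)
      qed
    qed
  qed
  from this[OF assms(1), THEN spec[of _ 0]] show ?thesis using p q0 by auto
qed

section \<open>The algorithm\<close>

lemma mset_sorted_list_of_set: "mset (sorted_list_of_set A) = mset_set A"
  by (metis mset_sorted_list_of_multiset sorted_list_of_mset_set)

text \<open>Since \<open>y\<close> is also a minimum of the list extended by \<open>x\<close>,
  evicting it affects only the rank after the last one considered.\<close>

lemma kth_largest_insert_full:
  assumes xs: "mset xs = add_mset y (mset zs)" and nn: "\<forall>z\<in>set xs. 0 \<le> z"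
    and y: "\<forall>z\<in>set xs. y \<le> z" "y \<le> x" and i: "1 \<le> i" "i \<le> length xs"
  shows "kth_largest (x # zs) i = kth_largest (x # xs) i"
proof -
  have s: "set xs = insert y (set zs)" by (metis xs set_mset_add_mset_insert set_mset_mset)
  have l: "length xs = Suc (length zs)" by (metis xs size_add_mset size_mset)
  have "kth_largest (x # xs) = kth_largest (y # x # zs)"
    by (rule kth_largest_cong_mset) (simp add: xs)
  then show ?thesis using kth_largest_Cons_le[of "x # zs" y i] s l nn y i by auto
qed

lemma kth_largest_length:
  assumes xs: "mset xs = add_mset y (mset zs)" and nn: "\<forall>z\<in>set xs. 0 \<le> z"
    and y: "\<forall>z\<in>set xs. y \<le> z"
  shows "kth_largest xs (length xs) = y"
proof -
  have s: "set xs = insert y (set zs)" by (metis xs set_mset_add_mset_insert set_mset_mset)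
  have l: "length xs = Suc (length zs)" by (metis xs size_add_mset size_mset)
  have "kth_largest xs = kth_largest (y # zs)"
    by (rule kth_largest_cong_mset) (simp add: xs)
  then show ?thesis using kth_largest_last[of zs y] s l nn y by auto
qed

section \<open>Invariants and the effect of a single step\<close>

locale streaming =
  fixes f :: "nat set \<Rightarrow> real" and m k :: nat and prt nb :: "nat \<Rightarrow> nat"
    and dd :: "nat \<Rightarrow> real" and opt :: "nat set"
    and sel :: "nat set \<Rightarrow> (nat \<Rightarrow> real) \<Rightarrow> nat" and p :: real
  assumes nonneg: "S \<subseteq> {1..m} \<Longrightarrow> 0 \<le> f S"
    and submod: "A \<subseteq> {1..m} \<Longrightarrow> B \<subseteq> {1..m} \<Longrightarrow> f (A \<union> B) + f (A \<inter> B) \<le> f A + f B"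
    and k_pos: "1 \<le> k"
    and part: "t \<in> {1..m} \<Longrightarrow> prt t \<in> {1..k}"
    and budgets: "a \<in> {1..k} \<Longrightarrow> 1 \<le> nb a"
    and dd_pos: "a \<in> {1..k} \<Longrightarrow> 0 < dd a"
    and p: "0 < p" "p < 1"
    and opt_sub: "opt \<subseteq> {1..m}"
    and opt_feas: "a \<in> {1..k} \<Longrightarrow> card (opt \<inter> {t. prt t = a}) \<le> nb a"
    and sel: "finite A \<Longrightarrow> A \<noteq> {} \<Longrightarrow> sel A w \<in> A \<and> (\<forall>x\<in>A. w (sel A w) \<le> w x)"
begin

lemma marginal_antimono:
  assumes "X \<subseteq> Y" "Y \<subseteq> {1..m}" "t \<in> {1..m}" "t \<notin> Y"
  shows "f (insert t Y) - f Y \<le> f (insert t X) - f X"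
proof -
  have "insert t X \<union> Y = insert t Y" "insert t X \<inter> Y = X" using assms by auto
  then show ?thesis using submod[of "insert t X" Y] assms by (auto simp: subset_iff)
qed

definition part_weight :: "nat \<Rightarrow> alg_state \<Rightarrow> real" where
  "part_weight a st = (case st of (S, w, \<beta>) \<Rightarrow> \<Sum>s \<in> S \<inter> {s. prt s = a}. w s)"

definition part_list :: "nat \<Rightarrow> nat set \<Rightarrow> (nat \<Rightarrow> real) \<Rightarrow> real list" where
  "part_list a S w = map w (sorted_list_of_set (S \<inter> {s. prt s = a}))"

text \<open>The last conjunct ranges over all subsets because evictions replace \<open>S\<close> by
  a smaller set; only the instance \<open>X = S\<close> is used at the end.\<close>

definition inv :: "nat \<Rightarrow> alg_state \<Rightarrow> bool" where
  "inv T st = (case st of (S, w, \<beta>) \<Rightarrow>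
     S \<subseteq> {1..T} \<and> (\<forall>a\<in>{1..k}. card (S \<inter> {s. prt s = a}) \<le> nb a) \<and> (\<forall>s\<in>S. 0 \<le> w s)
     \<and> (\<forall>a\<in>{1..k}. \<beta> a = thr (dd a) (nb a) (part_list a S w))
     \<and> (\<forall>X\<subseteq>S. f {} + sum w X \<le> f X))"

lemma mset_part_list:
  "finite S \<Longrightarrow> mset (part_list a S w) = image_mset w (mset_set (S \<inter> {s. prt s = a}))"
  by (simp add: part_list_def mset_sorted_list_of_set)

lemma inv_thr_nonneg: "inv T (S, w, \<beta>) \<Longrightarrow> a \<in> {1..k} \<Longrightarrow> 0 \<le> \<beta> a"
  using finite_subset[of S "{1..T}"] dd_pos[of a] budgets[of a]
  by (auto simp: inv_def part_list_def intro!: thr_nonneg)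

lemma alg_step_rejected:
  "\<not> (\<beta> (prt t) \<le> f (S \<union> {t}) - f S \<and> Z t) \<Longrightarrow>
    alg_step f prt nb dd sel Z t (S, w, \<beta>) = (S, w, \<beta>)"
  by (auto simp: alg_step_def Let_def)

lemma inv_mono: "inv T st \<Longrightarrow> inv (Suc T) st"
  by (auto simp: inv_def split: prod.splits)

text \<open>An acceptance changes only its own part, so \<open>thr_step\<close> and
  \<open>gain_bounds\<close> apply to the weight list of that part, with or without an
  eviction.\<close>

lemma alg_step_accepted:
  assumes I: "inv T (S, w, \<beta>)" and T: "Suc T \<le> m" and Z: "Z (Suc T)"
    and a: "a = prt (Suc T)" and x: "x = f (S \<union> {Suc T}) - f S" "\<beta> a \<le> x"
    and st': "alg_step f prt nb dd sel Z (Suc T) (S, w, \<beta>) = (S', w', \<beta>')"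
  shows "inv (Suc T) (S', w', \<beta>')" "S' \<subseteq> insert (Suc T) S" "Suc T \<in> S'"
    and "b \<noteq> a \<Longrightarrow> \<beta>' b = \<beta> b"
    and "b \<noteq> a \<Longrightarrow> part_weight b (S', w', \<beta>') = part_weight b (S, w, \<beta>)"
    and "\<beta> a \<le> \<beta>' a"
    and "x + real (nb a) * (\<beta>' a - \<beta> a) \<le> Q_par p (dd a) (nb a) *
      (part_weight a (S', w', \<beta>') - part_weight a (S, w, \<beta>))"
    and "(x - \<beta> a) / p + (real (nb a) - 1) * (\<beta>' a - \<beta> a) \<le> Q_par p (dd a) (nb a) *
      (part_weight a (S', w', \<beta>') - part_weight a (S, w, \<beta>))"
proof -
  define t where "t = Suc T"
  define P where "P c = {s. prt s = c}" for c
  define n d where "n = nb a" and "d = dd a"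
  have tm: "t \<in> {1..m}" using T by (simp add: t_def)
  have ak: "a \<in> {1..k}" using part tm a by (simp add: t_def)
  have n: "1 \<le> n" and d: "0 < d" using ak budgets dd_pos by (auto simp: n_def d_def)
  from I have S: "S \<subseteq> {1..T}" "\<And>c. c \<in> {1..k} \<Longrightarrow> card (S \<inter> P c) \<le> nb c" "\<And>s. s \<in> S \<Longrightarrow> 0 \<le> w s"
    and \<beta>: "\<And>c. c \<in> {1..k} \<Longrightarrow> \<beta> c = thr (dd c) (nb c) (part_list c S w)"
    and val: "\<And>X. X \<subseteq> S \<Longrightarrow> f {} + sum w X \<le> f X"
    by (auto simp: inv_def P_def)
  have fin: "finite S" using S(1) finite_subset by blast
  have tS: "t \<notin> S" using S(1) by (auto simp: t_def)
  have Pt: "t \<in> P c \<longleftrightarrow> c = a" for c using a by (auto simp: P_def t_def)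
  have x0: "0 \<le> x" using inv_thr_nonneg[OF I ak] x by simp
  define full where "full \<longleftrightarrow> \<not> card (S \<inter> P a) < n"
  define y where "y = sel (S \<inter> P a) w"
  define R where "R = (if full then S - {y} else S)"
  have S': "S' = insert t R" and w': "w' = w(t := x)"
    and \<beta>': "\<beta>' = \<beta>(a := thr d n (part_list a S' w'))"
    using st' Z x unfolding a
    by (auto simp: alg_step_def Let_def R_def y_def full_def n_def d_def P_def t_def a thr_def
        part_list_def split: if_splits)
  have y: "y \<in> S \<inter> P a" "\<forall>s\<in>S \<inter> P a. w y \<le> w s" if full
  proof -
    have "S \<inter> P a \<noteq> {}" using that n by (auto simp: full_def)
    then show "y \<in> S \<inter> P a" "\<forall>s\<in>S \<inter> P a. w y \<le> w s"
      using sel[of "S \<inter> P a" w] fin by (auto simp: y_def)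
  qed
  have R: "R \<subseteq> S" "t \<notin> R" "finite R" using fin tS by (auto simp: R_def)
  \<comment> \<open>The weight that leaves the part. The value 0 when there is room agrees with the
    default of \<open>kth_largest\<close> at rank \<open>n\<close>, which merges both cases.\<close>
  define wn where "wn = (if full then w y else 0)"
  let ?xs = "part_list a S w" and ?ys = "part_list a S' w'"
  have lxs: "length ?xs = card (S \<inter> P a)" by (simp add: part_list_def P_def)
  have len_full: "length ?xs = n" if full
    using that S(2)[OF ak] lxs by (simp add: full_def n_def)
  have sxs: "set ?xs = w ` (S \<inter> P a)" using fin by (simp add: part_list_def P_def)
  have nn: "\<forall>z\<in>set ?xs. 0 \<le> z" using S(3) sxs by auto
  have wcong: "w' s = w s" if "s \<in> R" for s using that R by (auto simp: w')
  have mys: "mset ?ys = add_mset x (image_mset w (mset_set (R \<inter> P a)))"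
  proof -
    have "S' \<inter> P a = insert t (R \<inter> P a)" using Pt by (auto simp: S')
    moreover have "image_mset w' (mset_set (R \<inter> P a)) = image_mset w (mset_set (R \<inter> P a))"
      using R by (intro image_mset_cong) (auto simp: wcong)
    ultimately show ?thesis using R by (simp add: mset_part_list S' w' flip: P_def)
  qed
  have wn: "kth_largest ?xs n = wn"
    and ys: "1 \<le> i \<Longrightarrow> i \<le> n \<Longrightarrow> kth_largest ?ys i = kth_largest (x # ?xs) i"
    and wnx: "wn \<le> x" and wn0: "0 \<le> wn" for i
  proof -
    have thr_a: "thr d n ?xs \<le> x" using x \<beta>[OF ak] by (simp add: n_def d_def)
    \<comment> \<open>As \<open>(1 + d) / d\<close> exceeds 1, the weight at rank \<open>n\<close>
      is below the threshold and hence below \<open>x\<close>.\<close>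
    have "kth_largest ?xs n \<le> (1 + d) / d * kth_largest ?xs n"
      using d kth_largest_nonneg[OF nn, of n] by (simp add: field_simps)
    then have kx: "kth_largest ?xs n \<le> x" using thr_ge[OF d n nn] thr_a by linarith
    have "kth_largest ?xs n = wn \<and>
      (1 \<le> i \<longrightarrow> i \<le> n \<longrightarrow> kth_largest ?ys i = kth_largest (x # ?xs) i)" for i
    proof (cases full)
      case True
      let ?zs = "map w (sorted_list_of_set (R \<inter> P a))"
      have "S \<inter> P a = insert y (R \<inter> P a)" "y \<notin> R \<inter> P a" using y[OF True] True by (auto simp: R_def)
      then have mx: "mset ?xs = add_mset (w y) (mset ?zs)"
        using R fin by (simp add: mset_part_list mset_sorted_list_of_set flip: P_def)
      have miny: "\<forall>z\<in>set ?xs. w y \<le> z" using y[OF True] sxs by auto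
      have last: "kth_largest ?xs n = w y"
        using kth_largest_length[OF mx nn miny] len_full[OF True] by simp
      have "kth_largest ?ys = kth_largest (x # ?zs)"
        by (rule kth_largest_cong_mset) (simp add: mys mset_sorted_list_of_set)
      then show ?thesis
        using kth_largest_insert_full[OF mx nn miny, of x i] kx last True len_full
        by (simp add: wn_def)
    next
      case False
      have "kth_largest ?ys = kth_largest (x # ?xs)"
        using False fin by (intro kth_largest_cong_mset) (simp add: mys R_def mset_part_list P_def)
      then show ?thesis using False lxs by (simp add: wn_def kth_largest_def full_def)
    qed
    then show "kth_largest ?xs n = wn" 
      and "1 \<le> i \<Longrightarrow> i \<le> n \<Longrightarrow> kth_largest ?ys i = kth_largest (x # ?xs) i" by auto
    then show "wn \<le> x" "0 \<le> wn" using kx kth_largest_nonneg[OF nn, of n] by auto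
  qed
  have W: "part_weight a (S', w', \<beta>') - part_weight a (S, w, \<beta>) = x - wn"
  proof -
    have "S' \<inter> P a = insert t (R \<inter> P a)" using Pt by (auto simp: S')
    then have "sum w' (S' \<inter> P a) = x + sum w (R \<inter> P a)"
      using R wcong by (simp add: w')
    moreover have "sum w (S \<inter> P a) = wn + sum w (R \<inter> P a)"
    proof (cases full)
      case True
      then have "S \<inter> P a = insert y (R \<inter> P a)" "y \<notin> R \<inter> P a" using y by (auto simp: R_def)
      then show ?thesis using True R by (simp add: wn_def)
    qed (simp add: R_def wn_def)
    ultimately show ?thesis by (simp add: part_weight_def P_def)
  qed
  have ba: "\<beta> a = thr d n ?xs" "\<beta>' a = thr d n ?ys" using \<beta>[OF ak] \<beta>' by (auto simp: d_def n_def)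
  note step = thr_step[OF d n nn x0 ys, unfolded wn, OF _ _ wnx]
  show mono: "\<beta> a \<le> \<beta>' a" unfolding ba by (rule step(1))
  have lo: "(1 + d) / d * wn \<le> \<beta> a" using thr_ge[OF d n nn] wn ba by simp
  note gain = gain_bounds[OF d n p(1) wn0 lo x(2) step(2)[folded ba]]
  show "x + real (nb a) * (\<beta>' a - \<beta> a) \<le> Q_par p (dd a) (nb a) *
      (part_weight a (S', w', \<beta>') - part_weight a (S, w, \<beta>))"
    using gain(1) unfolding W n_def d_def .
  show "(x - \<beta> a) / p + (real (nb a) - 1) * (\<beta>' a - \<beta> a) \<le> Q_par p (dd a) (nb a) *
      (part_weight a (S', w', \<beta>') - part_weight a (S, w, \<beta>))"
    using gain(2) unfolding W n_def d_def .
  show "S' \<subseteq> insert (Suc T) S" "Suc T \<in> S'" using R by (auto simp: S' t_def)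
  have other: "S' \<inter> P b = S \<inter> P b" if "b \<noteq> a" for b
  proof -
    have "y \<notin> P b" if full using y[OF that] \<open>b \<noteq> a\<close> by (auto simp: P_def)
    then show ?thesis using Pt[of b] that by (auto simp: S' R_def)
  qed
  show "\<beta>' b = \<beta> b" if "b \<noteq> a" for b using that by (simp add: \<beta>')
  have wS: "w' s = w s" if "s \<in> S" for s using that tS by (auto simp: w')
  show "part_weight b (S', w', \<beta>') = part_weight b (S, w, \<beta>)" if "b \<noteq> a" for b
    using other[OF that] wS by (simp add: part_weight_def flip: P_def)
  have "part_list b S' w' = part_list b S w" if "b \<noteq> a" for b
    using other[OF that] wS fin by (simp add: part_list_def flip: P_def)
  moreover have "f {} + sum w' X \<le> f X" if X: "X \<subseteq> S'" for X
  proof (cases "t \<in> X")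
    case True
    define X0 where "X0 = X - {t}"
    have X0: "X0 \<subseteq> S" "X = insert t X0" "t \<notin> X0" "finite X0"
      using True X R fin by (auto simp: X0_def S' intro: finite_subset)
    have "S \<subseteq> {1..m}" using S(1) T by auto
    \<comment> \<open>By diminishing returns, \<open>x\<close>, measured against all of
      \<open>S\<close>, is at most the marginal value over \<open>X0\<close>.\<close>
    then have "x \<le> f X - f X0" using marginal_antimono[OF X0(1) _ tm tS] x X0 by (simp add: t_def)
    moreover have "sum w' X = x + sum w X0"
      using X0 wS by (simp add: w' subset_iff)
    ultimately show ?thesis using val[OF X0(1)] by simp
  next
    case False
    then have "X \<subseteq> S" using X R by (auto simp: S')
    moreover from this have "sum w' X = sum w X" using wS by (auto intro!: sum.cong)
    ultimately show ?thesis using val by simp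
  qed
  moreover have "card (S' \<inter> P c) \<le> nb c" if "c \<in> {1..k}" for c
  proof (cases "c = a")
    case True
    have c: "card (S' \<inter> P a) = Suc (card (R \<inter> P a))"
      using R Pt by (simp add: S' Int_insert_left)
    show ?thesis
    proof (cases full)
      case True
      then have "S \<inter> P a = insert y (R \<inter> P a)" "y \<notin> R \<inter> P a" using y by (auto simp: R_def)
      then have "card (S \<inter> P a) = card (S' \<inter> P a)" using c R by simp
      then show ?thesis using S(2)[OF ak] \<open>c = a\<close> by simp
    next
      case False
      then show ?thesis using c \<open>c = a\<close> by (simp add: full_def R_def n_def)
    qed
  next
    case False
    then show ?thesis using other S(2) that by simp
  qed
  ultimately show "inv (Suc T) (S', w', \<beta>')"
    using R S x0 wS \<beta> \<beta>' unfolding inv_def prod.case P_def[symmetric]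
    by (auto simp: S' w' d_def n_def t_def)
qed


section \<open>Runs and the accepted elements\<close>

definition run :: "(nat \<Rightarrow> bool) \<Rightarrow> nat \<Rightarrow> alg_state" where
  "run Z T = foldl (\<lambda>st t. alg_step f prt nb dd sel Z t st) ({}, (\<lambda>_. 0), (\<lambda>_. 0)) [1..<Suc T]"

lemma run_0: "run Z 0 = ({}, (\<lambda>_. 0), (\<lambda>_. 0))"
  and run_Suc: "run Z (Suc T) = alg_step f prt nb dd sel Z (Suc T) (run Z T)"
  by (simp_all add: run_def)

text \<open>The first \<open>T\<close> steps read only the first \<open>T\<close> coins, so the
  state before a step is fixed while the coin of that step is averaged.\<close>

lemma run_upd: "T < t \<Longrightarrow> run (Z(t := b)) T = run Z T"
  by (induction T) (auto simp: run_0 run_Suc alg_step_def)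

text \<open>The elements ever accepted, evicted or not: each belongs to the state right after its
  own step.\<close>

definition added :: "(nat \<Rightarrow> bool) \<Rightarrow> nat \<Rightarrow> nat set" where
  "added Z T = (\<Union>s\<le>T. fst (run Z s))"

lemma added_0: "added Z 0 = {}"
  and added_Suc: "added Z (Suc T) = added Z T \<union> fst (run Z (Suc T))"
  and run_subset_added: "fst (run Z T) \<subseteq> added Z T"
  by (auto simp: added_def run_0 atMost_Suc)

lemma added_upd: "T < t \<Longrightarrow> added (Z(t := b)) T = added Z T"
  by (auto simp: added_def run_upd)

lemma inv_run: "T \<le> m \<Longrightarrow> inv T (run Z T)"
proof (induction T)
  case 0
  show ?case by (simp add: run_0 inv_def thr_def part_list_def kth_largest_def)
next
  case (Suc T)
  obtain S w \<beta> where st: "run Z T = (S, w, \<beta>)" by (cases "run Z T")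
  obtain S' w' \<beta>' where st': "alg_step f prt nb dd sel Z (Suc T) (S, w, \<beta>) = (S', w', \<beta>')"
    by (cases "alg_step f prt nb dd sel Z (Suc T) (S, w, \<beta>)")
  have I: "inv T (S, w, \<beta>)" using Suc st by simp
  show ?case
  proof (cases "\<beta> (prt (Suc T)) \<le> f (S \<union> {Suc T}) - f S \<and> Z (Suc T)")
    case True
    then show ?thesis
      using alg_step_accepted(1)[OF I Suc.prems _ refl refl _ st'] by (simp add: run_Suc st st')
  next
    case False
    then show ?thesis using inv_mono[OF I] by (simp add: run_Suc st alg_step_rejected)
  qed
qed

lemma added_subset: "T \<le> m \<Longrightarrow> added Z T \<subseteq> {s \<in> {1..T}. Z s}"
proof (induction T)
  case (Suc T)
  obtain S w \<beta> where st: "run Z T = (S, w, \<beta>)" by (cases "run Z T")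
  obtain S' w' \<beta>' where st': "alg_step f prt nb dd sel Z (Suc T) (S, w, \<beta>) = (S', w', \<beta>')"
    by (cases "alg_step f prt nb dd sel Z (Suc T) (S, w, \<beta>)")
  have I: "inv T (S, w, \<beta>)" using Suc inv_run[of T Z] st by simp
  have "S \<subseteq> added Z T" using run_subset_added[of Z T] st by simp
  moreover have "fst (run Z (Suc T)) \<subseteq> S \<union> {s. s = Suc T \<and> Z s}"
  proof (cases "\<beta> (prt (Suc T)) \<le> f (S \<union> {Suc T}) - f S \<and> Z (Suc T)")
    case True
    then show ?thesis
      using alg_step_accepted(2)[OF I Suc.prems _ refl refl _ st'] by (auto simp: run_Suc st st')
  next
    case False
    then show ?thesis by (simp add: run_Suc st alg_step_rejected)
  qed
  ultimately show ?case using Suc by (fastforce simp: added_Suc)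
qed (simp add: added_0)

section \<open>The potential and its drift\<close>

definition slack :: "nat \<Rightarrow> nat \<Rightarrow> real" where
  "slack a T = real (nb a) - real (card (opt \<inter> {1..T} \<inter> {s. prt s = a}))"

lemma slack_nonneg: "a \<in> {1..k} \<Longrightarrow> 0 \<le> slack a T"
proof -
  assume a: "a \<in> {1..k}"
  have "card (opt \<inter> {1..T} \<inter> {s. prt s = a}) \<le> card (opt \<inter> {t. prt t = a})"
    using finite_subset[OF opt_sub] by (intro card_mono) auto
  then show ?thesis using opt_feas[OF a] by (simp add: slack_def)
qed

lemma slack_le: "slack a T \<le> real (nb a)"
  by (simp add: slack_def)

lemma slack_Suc:
  "slack a (Suc T) = slack a T - of_bool (Suc T \<in> opt \<and> prt (Suc T) = a)"
proof -
  let ?X = "opt \<inter> {1..T} \<inter> {s. prt s = a}"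
  have "opt \<inter> {1..Suc T} \<inter> {s. prt s = a} =
      (if Suc T \<in> opt \<and> prt (Suc T) = a then insert (Suc T) ?X else ?X)"
    by (auto simp: le_Suc_eq)
  then show ?thesis by (simp add: slack_def)
qed

definition potential :: "nat \<Rightarrow> nat set \<Rightarrow> alg_state \<Rightarrow> real" where
  "potential T A st = f (opt \<inter> {1..T} \<union> A) + (\<Sum>a\<in>{1..k}. slack a T * snd (snd st) a)
     - (\<Sum>a\<in>{1..k}. Q_par p (dd a) (nb a) * part_weight a st)"

text \<open>Slack, threshold and weight of every other part are unchanged, so their summands
  cancel.\<close>

lemma potential_diff:
  assumes t: "Suc T \<le> m" and a: "a = prt (Suc T)"
    and eq: "\<And>b. b \<noteq> a \<Longrightarrow> snd (snd st') b = snd (snd st) b"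
      "\<And>b. b \<noteq> a \<Longrightarrow> part_weight b st' = part_weight b st"
  shows "potential (Suc T) A' st' - potential T A st =
    f (opt \<inter> {1..Suc T} \<union> A') - f (opt \<inter> {1..T} \<union> A)
    + (slack a (Suc T) * snd (snd st') a - slack a T * snd (snd st) a)
    - Q_par p (dd a) (nb a) * (part_weight a st' - part_weight a st)"
proof -
  have ak: "a \<in> {1..k}" using part t a by simp
  have "(\<Sum>b\<in>{1..k} - {a}. slack b (Suc T) * snd (snd st') b)
      = (\<Sum>b\<in>{1..k} - {a}. slack b T * snd (snd st) b)"
    using a eq by (intro sum.cong) (auto simp: slack_Suc)
  moreover have "(\<Sum>b\<in>{1..k} - {a}. Q_par p (dd b) (nb b) * part_weight b st')
      = (\<Sum>b\<in>{1..k} - {a}. Q_par p (dd b) (nb b) * part_weight b st)"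
    using eq by (intro sum.cong) auto
  moreover have "(\<Sum>b\<in>{1..k}. h b) = h a + (\<Sum>b\<in>{1..k} - {a}. h b)" for h :: "nat \<Rightarrow> real"
    using ak by (intro sum.remove) auto
  ultimately show ?thesis
    unfolding potential_def right_diff_distrib by simp
qed

text \<open>A rejected element of \<open>opt\<close> uses up one unit of slack, worth at least its weight if the
  threshold caused the rejection; if the coin did, the loss is compensated by the outcome in
  which the element is accepted.\<close>
lemma potential_step:
  assumes t: "Suc T \<le> m"
  shows "p * potential (Suc T) (added (Z(Suc T := True)) (Suc T)) (run (Z(Suc T := True)) (Suc T))
    + (1 - p) * potential (Suc T) (added (Z(Suc T := False)) (Suc T)) (run (Z(Suc T := False)) (Suc T))
    \<le> potential T (added Z T) (run Z T)"
proof -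
  let ?t = "Suc T"
  obtain S w \<beta> where st: "run Z T = (S, w, \<beta>)" by (cases "run Z T")
  define a where "a = prt ?t"
  define U where "U = opt \<inter> {1..T} \<union> added Z T"
  define x where "x = f (S \<union> {?t}) - f S"
  define \<Phi> where "\<Phi> b = potential ?t (added (Z(?t := b)) ?t) (run (Z(?t := b)) ?t)
    - potential T (added Z T) (run Z T)" for b
  have ak: "a \<in> {1..k}" and tm: "?t \<in> {1..m}" using part t by (simp_all add: a_def)
  have I: "inv T (S, w, \<beta>)" using inv_run[of T Z] t st by simp
  have SA: "S \<subseteq> added Z T" using run_subset_added[of Z T] st by simp
  have U: "S \<subseteq> U" "U \<subseteq> {1..m}" "?t \<notin> U"
    using SA added_subset[of T Z] t by (auto simp: U_def)
  \<comment> \<open>The weight is measured against \<open>S\<close>, which is contained in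
    \<open>U\<close>; hence the marginal value over \<open>U\<close> is no larger.\<close>
  have fU: "f (insert ?t U) - f U \<le> x"
    using marginal_antimono[OF U(1,2) tm U(3)] by (simp add: x_def)
  have opt_U: "opt \<inter> {1..?t} \<union> added Z T = (if ?t \<in> opt then insert ?t U else U)"
    by (auto simp: U_def le_Suc_eq)
  have sl: "slack a ?t = slack a T - of_bool (?t \<in> opt)" by (simp add: slack_Suc a_def)
  have sl0: "0 \<le> slack a ?t" using slack_nonneg[OF ak] .
  have b0: "0 \<le> \<beta> a" using inv_thr_nonneg[OF I ak] .
  \<comment> \<open>A rejection keeps the state, so the potential can move only if the element lies
    in \<open>opt\<close>: the union may gain it, and one unit of slack at price
    \<open>\<beta> a\<close> is lost.\<close>
  have reject: "\<Phi> b \<le> (if ?t \<in> opt then x - \<beta> a else 0)" if "\<not> (\<beta> a \<le> x \<and> b)" for b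
  proof -
    have r: "run (Z(?t := b)) ?t = run Z T"
      using that by (simp add: run_Suc run_upd st alg_step_rejected x_def a_def)
    have "added (Z(?t := b)) ?t = added Z T"
      using SA by (auto simp: added_Suc added_upd r st)
    then have "\<Phi> b = f (opt \<inter> {1..?t} \<union> added Z T) - f U + (slack a ?t * \<beta> a - slack a T * \<beta> a)"
      using potential_diff[OF t a_def, of "run Z T" "run Z T" "added Z T" "added Z T"]
      by (simp add: \<Phi>_def r U_def st)
    then show ?thesis using fU unfolding opt_U sl by (auto simp: algebra_simps)
  qed
  have "p * \<Phi> True + (1 - p) * \<Phi> False \<le> 0"
  proof (cases "\<beta> a \<le> x")
    case False
    then have "\<Phi> b \<le> 0" for b using reject[of b] by (auto split: if_splits)
    then have "p * \<Phi> True \<le> 0" "(1 - p) * \<Phi> False \<le> 0"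
      using p by (auto simp: mult_nonneg_nonpos)
    then show ?thesis by simp
  next
    case True
    obtain S' w' \<beta>' where
      st': "alg_step f prt nb dd sel (Z(?t := True)) ?t (S, w, \<beta>) = (S', w', \<beta>')"
      by (cases "alg_step f prt nb dd sel (Z(?t := True)) ?t (S, w, \<beta>)")
    note acc = alg_step_accepted[OF I t _ a_def x_def True st', simplified]
    have r: "run (Z(?t := True)) ?t = (S', w', \<beta>')" by (simp add: run_Suc run_upd st st')
    have "added (Z(?t := True)) ?t = insert ?t (added Z T)"
      using SA acc(2,3) by (auto simp: added_Suc added_upd r)
    moreover have "opt \<inter> {1..?t} \<union> insert ?t (added Z T) = insert ?t U"
      by (auto simp: U_def le_Suc_eq)
    ultimately have P: "\<Phi> True = f (insert ?t U) - f U + (slack a ?t * \<beta>' a - slack a T * \<beta> a)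
        - Q_par p (dd a) (nb a) * (part_weight a (S', w', \<beta>') - part_weight a (S, w, \<beta>))"
      using potential_diff[OF t a_def, of "(S', w', \<beta>')" "(S, w, \<beta>)"
          "insert ?t (added Z T)" "added Z T"] acc(4,5)
      by (simp add: \<Phi>_def r U_def st)
    let ?G = "Q_par p (dd a) (nb a) * (part_weight a (S', w', \<beta>') - part_weight a (S, w, \<beta>))"
    have D: "0 \<le> \<beta>' a - \<beta> a" using acc(6) by simp
    show ?thesis
    proof (cases "?t \<in> opt")
      case False
      have "slack a T * (\<beta>' a - \<beta> a) \<le> real (nb a) * (\<beta>' a - \<beta> a)"
        using D slack_le by (intro mult_right_mono)
      then have "\<Phi> True \<le> 0" using P fU acc(7) False by (simp add: sl algebra_simps)
      moreover have "\<Phi> False \<le> 0" using reject[of False] False by simp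
      ultimately have "p * \<Phi> True \<le> 0" "(1 - p) * \<Phi> False \<le> 0"
        using p by (auto simp: mult_nonneg_nonpos)
      then show ?thesis by simp
    next
      case True
      \<comment> \<open>The arriving element of \<open>opt\<close> has used one unit, so at most
        \<open>nb a - 1\<close> units are repriced.\<close>
      have "slack a ?t * (\<beta>' a - \<beta> a) \<le> (real (nb a) - 1) * (\<beta>' a - \<beta> a)"
        using D slack_le[of a T] True by (intro mult_right_mono) (auto simp: sl)
      then have "\<Phi> True \<le> x - \<beta> a + (real (nb a) - 1) * (\<beta>' a - \<beta> a) - ?G"
        using P fU True by (simp add: sl algebra_simps)
      then have "p * \<Phi> True \<le> p * (x - \<beta> a + (real (nb a) - 1) * (\<beta>' a - \<beta> a) - ?G)"
        using p by (intro mult_left_mono) auto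
      moreover have "(1 - p) * \<Phi> False \<le> (1 - p) * (x - \<beta> a)"
        using reject[of False] True p by (intro mult_left_mono) auto
      moreover have "p * ((x - \<beta> a) / p + (real (nb a) - 1) * (\<beta>' a - \<beta> a)) \<le> p * ?G"
        using acc(8) p by (intro mult_left_mono) auto
      then have "x - \<beta> a + p * ((real (nb a) - 1) * (\<beta>' a - \<beta> a)) \<le> p * ?G"
        using p by (simp add: distrib_left)
      moreover have "p * (x - \<beta> a + (real (nb a) - 1) * (\<beta>' a - \<beta> a) - ?G)
          = p * (x - \<beta> a) + p * ((real (nb a) - 1) * (\<beta>' a - \<beta> a)) - p * ?G"
        "(1 - p) * (x - \<beta> a) = (x - \<beta> a) - p * (x - \<beta> a)"
        by (simp_all only: algebra_simps)
      ultimately show ?thesis by linarith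
    qed
  qed
  then show ?thesis by (simp add: \<Phi>_def algebra_simps)
qed

section \<open>Expected values and the approximation guarantee\<close>

abbreviation expect :: "((nat \<Rightarrow> bool) \<Rightarrow> real) \<Rightarrow> real" where
  "expect F \<equiv> measure_pmf.expectation (coins p {1..m}) F"

text \<open>The potential starts at \<open>f {}\<close>, since all thresholds and weights are 0, and
  averaging \<open>potential_step\<close> over all coins shows that its expectation never
  grows.\<close>

lemma expect_potential: "T \<le> m \<Longrightarrow> expect (\<lambda>Z. potential T (added Z T) (run Z T)) \<le> f {}"
proof (induction T)
  case 0
  show ?case by (simp add: potential_def run_0 added_0 part_weight_def)
next
  case (Suc T)
  let ?F = "\<lambda>Z. potential (Suc T) (added Z (Suc T)) (run Z (Suc T))"
  have "expect ?F = expect (\<lambda>Z. p * ?F (Z(Suc T := True)) + (1 - p) * ?F (Z(Suc T := False)))"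
    using Suc.prems p by (intro expectation_coins_flip) auto
  also have "\<dots> \<le> expect (\<lambda>Z. potential T (added Z T) (run Z T))"
    by (intro integral_mono potential_step Suc.prems integrable_coins) auto
  finally show ?case using Suc by simp
qed

text \<open>The sampling bound is applied to the function mapping \<open>X\<close> to
  \<open>f (opt \<union> X)\<close>. Acceptances depend on each other, but only the individual
  probabilities enter, each at most \<open>p\<close> as acceptance requires heads.\<close>

lemma expect_opt_union: "(1 - p) * f opt \<le> expect (\<lambda>Z. f (opt \<union> added Z m))"
proof -
  have "(1 - p) * f (opt \<union> {}) \<le> expect (\<lambda>Z. f (opt \<union> ({1..m} \<inter> added Z m)))"
  proof (rule expectation_sampled_subset_ge)
    fix X Y t assume XY: "X \<subseteq> Y" "Y \<subseteq> {1..m}" "t \<in> {1..m}" "t \<notin> Y"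
    show "f (opt \<union> insert t Y) - f (opt \<union> Y) \<le> f (opt \<union> insert t X) - f (opt \<union> X)"
    proof (cases "t \<in> opt")
      case True
      then show ?thesis by (simp add: insert_absorb)
    next
      case False
      then show ?thesis
        using marginal_antimono[of "opt \<union> X" "opt \<union> Y" t] XY opt_sub by auto
    qed
  next
    fix t assume t: "t \<in> {1..m}"
    have "expect (\<lambda>Z. of_bool (t \<in> added Z m)) \<le> expect (\<lambda>Z. of_bool (Z t))"
      using added_subset[of m] by (intro integral_mono) (auto simp: of_bool_def)
    then show "expect (\<lambda>Z. of_bool (t \<in> added Z m)) \<le> p"
      using expectation_coins_single[OF _ t] p by simp
  qed (use opt_sub nonneg p in auto)
  moreover have "{1..m} \<inter> added Z m = added Z m" for Z using added_subset[of m Z] by auto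
  ultimately show ?thesis by simp
qed

lemma Q_par_ge_1: "a \<in> {1..k} \<Longrightarrow> 1 \<le> Q_par p (dd a) (nb a)"
  using c_par_facts(2)[of "dd a" "nb a"] dd_pos[of a] budgets[of a]
  by (auto simp: Q_par_def le_max_iff_disj)

lemma weight_bounds:
  shows "0 \<le> part_weight a (run Z m)"
    and "f {} + (\<Sum>a\<in>{1..k}. part_weight a (run Z m)) \<le> f (fst (run Z m))"
proof -
  obtain S w \<beta> where st: "run Z m = (S, w, \<beta>)" by (cases "run Z m")
  then have I: "S \<subseteq> {1..m}" "\<forall>s\<in>S. 0 \<le> w s" "f {} + sum w S \<le> f S"
    using inv_run[of m Z] by (auto simp: inv_def)
  then have fin: "finite S" using finite_subset by blast
  show "0 \<le> part_weight a (run Z m)"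
    using I by (auto simp: st part_weight_def intro!: sum_nonneg)
  have "(\<Sum>a\<in>{1..k}. \<Sum>s\<in>{s \<in> S. prt s = a}. w s) = sum w S"
    using fin I part by (intro sum.group) auto
  then show "f {} + (\<Sum>a\<in>{1..k}. part_weight a (run Z m)) \<le> f (fst (run Z m))"
    using I by (simp add: st part_weight_def Int_def)
qed

lemma potential_final:
  assumes q: "\<And>a. a \<in> {1..k} \<Longrightarrow> Q_par p (dd a) (nb a) \<le> q"
  shows "f (opt \<union> added Z m) \<le>
    potential m (added Z m) (run Z m) + q * (\<Sum>a\<in>{1..k}. part_weight a (run Z m))"
proof -
  obtain S w \<beta> where st: "run Z m = (S, w, \<beta>)" by (cases "run Z m")
  then have I: "inv m (S, w, \<beta>)" using inv_run[of m Z] by simp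
  have "0 \<le> (\<Sum>a\<in>{1..k}. slack a m * snd (snd (run Z m)) a)"
    using slack_nonneg inv_thr_nonneg[OF I] by (intro sum_nonneg) (simp add: st)
  moreover have "(\<Sum>a\<in>{1..k}. Q_par p (dd a) (nb a) * part_weight a (run Z m))
      \<le> (\<Sum>a\<in>{1..k}. q * part_weight a (run Z m))"
    using q weight_bounds(1) by (intro sum_mono mult_right_mono) auto
  moreover have "opt \<inter> {1..m} = opt" using opt_sub by auto
  ultimately show ?thesis by (simp add: potential_def sum_distrib_left)
qed

lemma alg_expect_eq: "alg_expect p f prt nb dd sel m = expect (\<lambda>Z. f (fst (run Z m)))"
  by (simp add: alg_expect_def alg_run_def run_def)

theorem approximation:
  assumes \<rho>: "0 < \<rho>" "\<And>a. a \<in> {1..k} \<Longrightarrow> \<rho> \<le> (1 - p) / Q_par p (dd a) (nb a)"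
  shows "\<rho> * f opt \<le> alg_expect p f prt nb dd sel m"
proof -
  \<comment> \<open>The largest value of \<open>Q_par\<close> compatible with the ratio
    \<open>\<rho>\<close>.\<close>
  define q where "q = (1 - p) / \<rho>"
  have q: "Q_par p (dd a) (nb a) \<le> q" if "a \<in> {1..k}" for a
    using \<rho>(1) \<rho>(2)[OF that] Q_par_ge_1[OF that] by (simp add: q_def field_simps)
  have "1 \<in> {1..k}" using k_pos by simp
  then have q1: "1 \<le> q" using q Q_par_ge_1 order_trans by blast
  let ?W = "\<lambda>Z. \<Sum>a\<in>{1..k}. part_weight a (run Z m)"
  note expect_opt_union
  also have "expect (\<lambda>Z. f (opt \<union> added Z m)) \<le>
      expect (\<lambda>Z. potential m (added Z m) (run Z m) + q * ?W Z)"
    using potential_final[OF q] by (intro integral_mono) auto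
  also have "\<dots> = expect (\<lambda>Z. potential m (added Z m) (run Z m)) + q * expect ?W"
    by simp
  finally have 1: "(1 - p) * f opt \<le> f {} + q * expect ?W"
    using expect_potential[of m] by simp
  have "f {} + expect ?W = expect (\<lambda>Z. f {} + ?W Z)" by simp
  also have "\<dots> \<le> alg_expect p f prt nb dd sel m"
    unfolding alg_expect_eq using weight_bounds(2) by (intro integral_mono) auto
  finally have "q * (f {} + expect ?W) \<le> q * alg_expect p f prt nb dd sel m"
    using q1 by (intro mult_left_mono) auto
  \<comment> \<open>Since \<open>q \<ge> 1\<close>, the term \<open>f {}\<close> may be scaled by
    \<open>q\<close> as well, which makes the whole bound a multiple of \<open>f {}\<close> plus the
    total weight.\<close>
  moreover have "1 * f {} \<le> q * f {}" using q1 nonneg[of "{}"] by (intro mult_right_mono) auto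
  ultimately have "(1 - p) * f opt \<le> q * alg_expect p f prt nb dd sel m"
    using 1 by (simp add: distrib_left)
  then have "\<rho> * ((1 - p) * f opt) \<le> \<rho> * (q * alg_expect p f prt nb dd sel m)"
    using \<rho>(1) by (intro mult_left_mono) auto
  then have "(1 - p) * (\<rho> * f opt) \<le> (1 - p) * alg_expect p f prt nb dd sel m"
    using \<rho>(1) by (simp add: q_def mult.left_commute)
  then show ?thesis using p by simp
qed

end

section \<open>The numerical ratios\<close>

text \<open>Combines \<open>ln (1 + x) \<ge> x - x^2 / 2\<close> with
  \<open>exp (- z) \<ge> 1 - z\<close>. The resulting factor is affine in \<open>1 / n\<close>,
  which the concavity argument in \<open>ratio_large\<close> relies on.\<close>

lemma power_ge_exp:
  fixes d :: real
  assumes "0 < d" "1 \<le> n"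
  shows "exp d * (1 - d\<^sup>2 / (2 * real n)) \<le> (1 + d / real n) ^ n"
proof -
  have "d / real n - (d / real n)\<^sup>2 / 2 \<le> ln (1 + d / real n)"
  proof -
    let ?h = "\<lambda>x::real. ln (1 + x) - x + x\<^sup>2 / 2"
    have "?h 0 \<le> ?h (d / real n)"
    \<comment> \<open>The derivative equals \<open>x^2 / (1 + x)\<close>.\<close>
    proof (rule DERIV_nonneg_imp_nondecreasing[where f = ?h])
      fix x :: real assume "0 \<le> x" "x \<le> d / real n"
      then have "(?h has_real_derivative 1 / (1 + x) - 1 + x) (at x)"
        by (auto intro!: derivative_eq_intros)
      moreover have "0 \<le> 1 / (1 + x) - 1 + x" using \<open>0 \<le> x\<close> by (simp add: field_simps)
      ultimately show "\<exists>y. (?h has_real_derivative y) (at x) \<and> 0 \<le> y" by blast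
    qed (use assms in simp)
    then show ?thesis by simp
  qed
  then have "real n * (d / real n - (d / real n)\<^sup>2 / 2) \<le> real n * ln (1 + d / real n)"
    by (intro mult_left_mono) auto
  moreover have "real n * (d / real n - (d / real n)\<^sup>2 / 2) = d - d\<^sup>2 / (2 * real n)"
    using assms by (simp add: field_simps power2_eq_square)
  ultimately have "exp (d - d\<^sup>2 / (2 * real n)) \<le> exp (real n * ln (1 + d / real n))" by simp
  also have "\<dots> = (1 + d / real n) ^ n"
    using assms by (simp add: exp_of_nat_mult exp_ln add_pos_nonneg)
  finally have "exp d * exp (- (d\<^sup>2 / (2 * real n))) \<le> (1 + d / real n) ^ n"
    by (simp add: exp_diff exp_minus field_simps)
  moreover have "exp d * (1 - d\<^sup>2 / (2 * real n)) \<le> exp d * exp (- (d\<^sup>2 / (2 * real n)))"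
    using exp_ge_add_one_self[of "- (d\<^sup>2 / (2 * real n))"] by simp
  ultimately show ?thesis by linarith
qed

lemma exp_one_ge: "(27182 / 10000 :: real) \<le> exp 1"
  using e_approx_32 by (simp add: abs_if split: if_splits)

text \<open>Cubing reduces the claim to a rational lower bound for the seventh power of e.\<close>

lemma exp_7_3_ge: "(103 / 10 :: real) \<le> exp (7 / 3)"
proof -
  have "(103 / 10 :: real) ^ 3 \<le> (27182 / 10000) ^ 7" by (simp add: power_divide)
  also have "\<dots> \<le> exp 1 ^ 7" using exp_one_ge by (intro power_mono) auto
  also have "\<dots> = exp (7 / 3) ^ 3" by (simp flip: exp_of_nat_mult)
  finally show ?thesis by (rule power_le_imp_le_base[of _ 2, simplified]) auto
qed

text \<open>The exponent is split as \<open>2 - 0.0468\<close>, and the second factor is at least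
  \<open>1 - 0.0468\<close>.\<close>

lemma exp_19532_ge: "(704 / 100 :: real) \<le> exp (19532 / 10000)"
proof -
  have "(704 / 100 :: real) \<le> (27182 / 10000) ^ 2 * (9532 / 10000)" by (simp add: power2_eq_square)
  also have "\<dots> \<le> exp 1 ^ 2 * exp (- (468 / 10000))"
    using exp_one_ge exp_ge_add_one_self[of "- (468 / 10000) :: real"]
    by (intro mult_mono power_mono) auto
  also have "\<dots> = exp (19532 / 10000)" by (simp flip: exp_of_nat_mult exp_add)
  finally show ?thesis .
qed

text \<open>The two entries of the maximum differ only by the factor \<open>1 - 1 / n\<close>, since \<open>1 / p = 1 + d\<close>.\<close>
lemma ratio_large:
  fixes d E r s :: real
  assumes d: "0 < d" and n: "11 \<le> n" and p: "p = 1 / (1 + d)" and E: "0 \<le> E" "E \<le> exp d"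
    and dn: "d\<^sup>2 < 22" and r: "0 < r" "0 \<le> s" "s < 11"
    and at0: "1 + d \<le> (E - 1) * (d / (1 + d) / r - (1 + d))"
    and at11: "1 + d \<le> (E * (1 - d\<^sup>2 / 22) - 1) * (d / (1 + d) / r * (1 + s / 11) - (1 + d))"
    and pos: "0 < d / (1 + d) / r - (1 + d)"
  shows "r * (1 - s / real n) \<le> (1 - p) / Q_par p d n"
proof -
  define y where "y = 1 / real n"
  have y: "0 < y" "y \<le> 1 / 11" using n by (auto simp: y_def field_simps)
  define X where "X = (1 + d / real n) ^ n"
  \<comment> \<open>This is \<open>(1 - p) / r\<close>. It suffices to show that
    \<open>Q_par\<close> is at most \<open>R * (1 + s * y)\<close>, because
    \<open>(1 - s * y) * (1 + s * y)\<close> is at most 1.\<close>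
  define R where "R = d / (1 + d) / r"
  have "E * (1 - d\<^sup>2 / 2 * y) \<le> exp d * (1 - d\<^sup>2 / 2 * y)"
  proof (rule mult_right_mono)
    have "d\<^sup>2 / 2 * y \<le> 11 * (1 / 11)" using dn y by (intro mult_mono) auto
    then show "0 \<le> 1 - d\<^sup>2 / 2 * y" by simp
  qed (rule E)
  also have "\<dots> \<le> X" using power_ge_exp[OF d, of n] n by (simp add: X_def y_def)
  finally have X: "E * (1 - d\<^sup>2 / 2 * y) \<le> X" .
  have X1: "1 < X" using d n by (simp add: X_def one_less_power)
  have R: "0 < R" "1 + d < R" using pos d by (auto simp: R_def)
  have RH: "0 < R * (1 + s * y) - (1 + d)"
  proof -
    have "R * 1 \<le> R * (1 + s * y)" using R r y by (intro mult_left_mono) auto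
    then show ?thesis using R by linarith
  qed
  have "(1 + d) \<le> (E * (1 - d\<^sup>2 / 2 * y) - 1) * (R * (1 + s * y) - (1 + d))"
  \<comment> \<open>The right-hand side is concave in y, so it suffices to compare at the ends 0 and 1 / 11.\<close>
  proof -
    let ?q = "\<lambda>y. (E * (1 - d\<^sup>2 / 2 * y) - 1) * (R * (1 + s * y) - (1 + d))"
    have "?q y = (1 - 11 * y) * ?q 0 + 11 * y * ?q (1 / 11)
        + E * d\<^sup>2 / 2 * R * s * (y * (1 / 11 - y))"
      by (simp add: field_simps power2_eq_square)
    moreover have "(1 - 11 * y) * (1 + d) \<le> (1 - 11 * y) * ?q 0"
      using at0 y by (intro mult_left_mono) (auto simp: R_def)
    moreover have "11 * y * (1 + d) \<le> 11 * y * ?q (1 / 11)"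
      using at11 y by (intro mult_left_mono) (auto simp: R_def)
    moreover have "0 \<le> E * d\<^sup>2 / 2 * R * s * (y * (1 / 11 - y))"
      using E R r y by (intro mult_nonneg_nonneg) auto
    moreover have "(1 - 11 * y) * (1 + d) + 11 * y * (1 + d) = 1 + d" by (simp add: algebra_simps)
    ultimately show ?thesis by linarith
  qed
  also have "\<dots> \<le> (X - 1) * (R * (1 + s * y) - (1 + d))"
    using X RH by (intro mult_right_mono) auto
  finally have "c_par d n \<le> R * (1 + s * y) - (1 + d)"
    using X1 by (simp add: c_par_def flip: X_def) (simp add: field_simps)
  moreover have c: "0 < c_par d n" using X1 d by (simp add: c_par_def flip: X_def)
  moreover have "(1 - 1 / real n) * c_par d n \<le> 1 * c_par d n"
    using c by (intro mult_right_mono) auto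
  ultimately have Q: "Q_par p d n \<le> R * (1 + s * y)" "0 < Q_par p d n"
    using d p by (auto simp: Q_par_def less_max_iff_disj)
  have sy: "s * y < 1" using n r by (simp add: y_def field_simps)
  have "r * (1 - s * y) * Q_par p d n \<le> r * (1 - s * y) * (R * (1 + s * y))"
    using Q sy r by (intro mult_left_mono) auto
  also have "\<dots> = (R * r) * (1 - (s * y)\<^sup>2)" by (simp add: algebra_simps power2_eq_square)
  also have "R * r = d / (1 + d)" using r by (simp add: R_def)
  also have "d / (1 + d) * (1 - (s * y)\<^sup>2) \<le> d / (1 + d) * 1" using d by (intro mult_left_mono) auto
  also have "\<dots> = 1 - p" using d by (simp add: p field_simps)
  finally show ?thesis using Q(2) by (simp add: y_def pos_le_divide_eq)
qed

lemma ratio_small_budget_large: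
  "11 \<le> n \<Longrightarrow> 0.1896 * (1 - 0.7771 / real n) \<le> (1 - 3 / 10) / Q_par (3 / 10) (7 / 3) n"
  by (rule ratio_large[where E = "103 / 10"]) (use exp_7_3_ge in \<open>auto simp: power2_eq_square\<close>)

lemma ratio_large_budget:
  fixes d p :: real
  assumes "d = 1.9532" "p = 1 / (d + 1)" "11 \<le> n"
  shows "0.1921 * (1 - 0.7676 / real n) \<le> (1 - p) / Q_par p d n"
  unfolding assms(2) unfolding assms(1)
  by (rule ratio_large[where E = "704 / 100"])
     (use exp_19532_ge assms(3) in \<open>auto simp: power2_eq_square\<close>)

lemma ratio_small_bound:
  assumes "1 \<le> n" "n \<le> 10"
  shows "ratio_small n \<le> (1 - 3 / 10) / Q_par (3 / 10) (d_small n) n"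
proof -
  have "n = 1 \<or> n = 2 \<or> n = 3 \<or> n = 4 \<or> n = 5 \<or> n = 6 \<or> n = 7 \<or> n = 8 \<or> n = 9 \<or> n = 10"
    using assms by presburger
  then show ?thesis
    by (elim disjE; hypsubst)
       (simp_all add: ratio_small_def d_small_def Q_par_def c_par_def power_divide)
qed

lemma ratio_small_ge: "1 \<le> n \<Longrightarrow> n \<le> 10 \<Longrightarrow> 0.175 \<le> ratio_small n"
  by (auto simp: ratio_small_def nth_Cons split: nat.splits)

lemma d_small_pos: "0 < d_small n"
  by (auto simp: d_small_def nth_Cons split: nat.splits)

theorem mainTheorem13:
  fixes f :: "nat set \<Rightarrow> real" and m k :: nat and prt nb :: "nat \<Rightarrow> nat"
    and Sstar :: "nat set" and sel :: "nat set \<Rightarrow> (nat \<Rightarrow> real) \<Rightarrow> nat"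
  assumes nonneg: "\<forall>S. S \<subseteq> {1..m} \<longrightarrow> 0 \<le> f S"
    and submod: "\<forall>A B. A \<subseteq> {1..m} \<and> B \<subseteq> {1..m} \<longrightarrow> f (A \<union> B) + f (A \<inter> B) \<le> f A + f B"
    and k_pos: "1 \<le> k"
    and part: "\<forall>t\<in>{1..m}. prt t \<in> {1..k}"
    and budgets: "\<forall>a\<in>{1..k}. 1 \<le> nb a"
    and opt_sub: "Sstar \<subseteq> {1..m}"
    and opt_feas: "\<forall>a\<in>{1..k}. card (Sstar \<inter> {t. prt t = a}) \<le> nb a"
    and opt_max: "\<forall>S. S \<subseteq> {1..m} \<and> (\<forall>a\<in>{1..k}. card (S \<inter> {t. prt t = a}) \<le> nb a)
                    \<longrightarrow> f S \<le> f Sstar"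
    and sel: "\<forall>A w. finite A \<and> A \<noteq> {} \<longrightarrow> sel A w \<in> A \<and> (\<forall>x\<in>A. w (sel A w) \<le> w x)"
  shows
   "(Min (nb ` {1..k}) \<le> 10 \<longrightarrow>
      (let p = (3/10::real); dd = (\<lambda>a. d_small (nb a)) in
        (\<forall>a\<in>{1..k}. nb a \<le> 10 \<longrightarrow> ratio_small (nb a) \<le> (1 - p) / Q_par p (dd a) (nb a)) \<and>
        (\<forall>a\<in>{1..k}. 11 \<le> nb a \<longrightarrow>
            0.1896 * (1 - 0.7771 / real (nb a)) \<le> (1 - p) / Q_par p (dd a) (nb a)) \<and>
        (MIN a\<in>{1..k}. (1 - p) / Q_par p (dd a) (nb a)) * f Sstar
            \<le> alg_expect p f prt nb dd sel m \<and>
        0.175 * f Sstar \<le> alg_expect p f prt nb dd sel m)) \<and>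
    (11 \<le> Min (nb ` {1..k}) \<longrightarrow>
      (let d = (1.9532::real); p = 1 / (d + 1); dd = (\<lambda>_. d) in
        (\<forall>a\<in>{1..k}. 0.1921 * (1 - 0.7676 / real (nb a)) \<le> (1 - p) / Q_par p (dd a) (nb a)) \<and>
        (MIN a\<in>{1..k}. (1 - p) / Q_par p (dd a) (nb a)) * f Sstar
            \<le> alg_expect p f prt nb dd sel m \<and>
        0.175 * f Sstar \<le> alg_expect p f prt nb dd sel m \<and>
        0.1921 * (1 - 0.7676 / real (Min (nb ` {1..k}))) * f Sstar
            \<le> alg_expect p f prt nb dd sel m))"
proof (intro conjI impI)
  have approx: "\<rho> * f Sstar \<le> alg_expect p f prt nb dd sel m"
    if "0 < p" "p < 1" "\<And>a. a \<in> {1..k} \<Longrightarrow> 0 < dd a" "0 < \<rho>"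
      "\<And>a. a \<in> {1..k} \<Longrightarrow> \<rho> \<le> (1 - p) / Q_par p (dd a) (nb a)" for p dd \<rho>
  proof -
    interpret streaming f m k prt nb dd Sstar sel p
      using that nonneg submod k_pos part budgets opt_sub opt_feas sel by unfold_locales auto
    show ?thesis using that by (intro approximation)
  qed
  have min_approx: "(MIN a\<in>{1..k}. (1 - p) / Q_par p (dd a) (nb a)) * f Sstar
      \<le> alg_expect p f prt nb dd sel m"
    if p: "0 < p" "p < 1" and dd: "\<And>a. a \<in> {1..k} \<Longrightarrow> 0 < dd a"
      and r: "\<And>a. a \<in> {1..k} \<Longrightarrow> 0.175 \<le> (1 - p) / Q_par p (dd a) (nb a)" for p dd
  proof (rule approx[OF p dd])
    \<comment> \<open>The uniform bound 0.175 guarantees that the minimum is positive, as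
      \<open>approx\<close> requires of \<open>\<rho>\<close>.\<close>
    have "{1..k} \<noteq> {}" using k_pos by simp
    moreover have "0 < (1 - p) / Q_par p (dd a) (nb a)" if "a \<in> {1..k}" for a
      by (rule less_le_trans[OF _ r[OF that]]) simp
    ultimately show "0 < (MIN a\<in>{1..k}. (1 - p) / Q_par p (dd a) (nb a))"
      by (subst Min_gr_iff) auto
  qed (auto intro!: Min_le)
  let ?p = "3 / 10 :: real" and ?dd = "\<lambda>a. d_small (nb a)"
  have s10: "ratio_small (nb a) \<le> (1 - ?p) / Q_par ?p (?dd a) (nb a)"
    if "a \<in> {1..k}" "nb a \<le> 10" for a
    using ratio_small_bound budgets that by auto
  have s11: "0.1896 * (1 - 0.7771 / real (nb a)) \<le> (1 - ?p) / Q_par ?p (?dd a) (nb a)"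
    if "11 \<le> nb a" for a
    using ratio_small_budget_large[OF that] that by (simp add: d_small_def)
  have s: "0.175 \<le> (1 - ?p) / Q_par ?p (?dd a) (nb a)" if a: "a \<in> {1..k}" for a
  proof (cases "nb a \<le> 10")
    case True
    then show ?thesis using s10[OF a True] ratio_small_ge[of "nb a"] budgets a by auto
  next
    case False
    \<comment> \<open>At \<open>n = 11\<close> the bound \<open>0.1896 * (1 - 0.7771 / n)\<close> is
      about 0.1762, already above 0.175.\<close>
    then have "0.7771 / real (nb a) \<le> 0.7771 / 11" by (intro divide_left_mono) auto
    then show ?thesis using s11[of a] False by simp
  qed
  have dd: "0 < ?dd a" if "a \<in> {1..k}" for a using d_small_pos .
  show "let p = ?p; dd = ?dd in
      (\<forall>a\<in>{1..k}. nb a \<le> 10 \<longrightarrow> ratio_small (nb a) \<le> (1 - p) / Q_par p (dd a) (nb a)) \<and>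
      (\<forall>a\<in>{1..k}. 11 \<le> nb a \<longrightarrow>
          0.1896 * (1 - 0.7771 / real (nb a)) \<le> (1 - p) / Q_par p (dd a) (nb a)) \<and>
      (MIN a\<in>{1..k}. (1 - p) / Q_par p (dd a) (nb a)) * f Sstar
          \<le> alg_expect p f prt nb dd sel m \<and>
      0.175 * f Sstar \<le> alg_expect p f prt nb dd sel m"
    unfolding Let_def
    by (intro conjI ballI impI s10 s11 min_approx approx s dd) auto
  let ?d = "1.9532 :: real"
  let ?p' = "1 / (?d + 1)" and ?n = "Min (nb ` {1..k})"
  assume "11 \<le> ?n"
  have n: "11 \<le> nb a" "real ?n \<le> real (nb a)" if "a \<in> {1..k}" for a
    using \<open>11 \<le> ?n\<close> that Min_le[of "nb ` {1..k}" "nb a"] by auto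
  have l: "0.1921 * (1 - 0.7676 / real (nb a)) \<le> (1 - ?p') / Q_par ?p' ?d (nb a)"
    if "a \<in> {1..k}" for a
    using ratio_large_budget[OF refl refl n(1)[OF that]] .
  have ln: "0.1921 * (1 - 0.7676 / real ?n) \<le> (1 - ?p') / Q_par ?p' ?d (nb a)"
    if "a \<in> {1..k}" for a
  proof -
    \<comment> \<open>The bound increases with the budget, so the smallest budget is the worst
      case.\<close>
    have "0.7676 / real (nb a) \<le> 0.7676 / real ?n"
      using n[OF that] \<open>11 \<le> ?n\<close> by (intro divide_left_mono) auto
    then have "0.1921 * (1 - 0.7676 / real ?n) \<le> 0.1921 * (1 - 0.7676 / real (nb a))"
      by (intro mult_left_mono diff_left_mono) auto
    then show ?thesis using l[OF that] by (rule order_trans)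
  qed
  have n11: "0.7676 / real ?n \<le> 0.7676 / 11"
    using \<open>11 \<le> ?n\<close> by (intro divide_left_mono) auto
  have l175: "0.175 \<le> (1 - ?p') / Q_par ?p' ?d (nb a)" if "a \<in> {1..k}" for a
    by (rule order_trans[OF _ ln[OF that]]) (use n11 in simp)
  have n0: "0 < 0.1921 * (1 - 0.7676 / real ?n)" using n11 by simp
  have p': "0 < ?p'" "?p' < 1" and d: "0 < ?d" by simp_all
  show "let d = ?d; p = 1 / (d + 1); dd = (\<lambda>_. d) in
      (\<forall>a\<in>{1..k}. 0.1921 * (1 - 0.7676 / real (nb a)) \<le> (1 - p) / Q_par p (dd a) (nb a)) \<and>
      (MIN a\<in>{1..k}. (1 - p) / Q_par p (dd a) (nb a)) * f Sstar
          \<le> alg_expect p f prt nb dd sel m \<and>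
      0.175 * f Sstar \<le> alg_expect p f prt nb dd sel m \<and>
      0.1921 * (1 - 0.7676 / real ?n) * f Sstar \<le> alg_expect p f prt nb dd sel m"
    unfolding Let_def
    by (intro conjI ballI l min_approx[OF p' d l175] approx[OF p' d _ l175] approx[OF p' d n0 ln])
      simp_all
qed

end
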